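(* Assume the Continuum Hypothesis. Let $\rho_i:\mathcal{F}_i\to[\Lambda_i]^\omega$ be partition regular functions for $i=1,2$. If $\rho_1$ is $P^-$ and $\mathcal{I}_{\rho_2}\not\leq_K\mathcal{I}_{\rho_1}$, then there exists an almost disjoint family $\mathcal{A}$ (on a countably infinite set) such that $|\mathcal{A}|=\mathfrak{c}$ and $\Phi(\mathcal{A})\in\mathrm{FinBW}(\rho_1)\setminus\mathrm{FinBW}(\rho_2)$. In particular, there is a Hausdorff compact and separable space of cardinality $\mathfrak{c}$ in $\mathrm{FinBW}(\rho_1)\setminus\mathrm{FinBW}(\rho_2)$.
   Context: $[A]^\omega$ is the family of infinite countable subsets of $A$. Partition regular functions: let $\Lambda,\Omega$ be countably infinite, and let $\mathcal{F}$ be a nonempty family of infinite subsets of $\Omega$ such that $F\setminus K\in\mathcal{F}$ for all $F\in\mathcal{F}$ and finite $K\subseteq\Omega$. A function $\rho:\mathcal{F}\to[\Lambda]^\omega$ is partition regular if (M) for all $E,F\in\mathcal{F}$, $E\subseteq F$ implies $\rho(E)\subseteq\rho(F)$; (R) for all $F\in\mathcal{F}$ and $A,B\subseteq\Lambda$ with $\rho(F)=A\cup B$ there is $E\in\mathcal{F}$ with $\rho(E)\subseteq A$ or $\rho(E)\subseteq B$; (S) for every $F\in\mathcal{F}$ there is $E\in\mathcal{F}$ with $E\subseteq F$ such that for every $a\in\rho(E)$ there is a finite $K\subseteq\Omega$ with $a\notin\rho(E\setminus K)$. Put $\mathcal{I}_\rho=\{A\subseteq\Lambda:\forall F\in\mathcal{F}\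 \rho(F)\not\subseteq A\}$ (an ideal on $\Lambda$) and $\mathcal{I}_\rho^+=\mathcal{P}(\Lambda)\setminus\mathcal{I}_\rho$. $\rho$ is $P^-$ if for every $\subseteq$-decreasing sequence $(A_n)_{n\in\omega}$ in $\mathcal{I}_\rho^+$ with $A_n\setminus A_{n+1}\in\mathcal{I}_\rho$ for all $n$ there is $F\in\mathcal{F}$ such that for each $n$ there is a finite $K\subseteq\Omega$ with $\rho(F\setminus K)\subseteq A_n$. Katětov order: for ideals $\mathcal{I}_i$ on $\Lambda_i$ ($i=1,2$), $\mathcal{I}_2\leq_K\mathcal{I}_1$ if there is $\phi:\Lambda_1\to\Lambda_2$ with $\phi[A]\notin\mathcal{I}_2$ for each $A\notin\mathcal{I}_1$. For $F\in\mathcal{F}$, $f:\rho(F)\to X$ is $\rho$-convergent to $x\in X$ if for every neighbourhood $U$ of $x$ there is a finite $K\subseteq\Omega$ with $f[\rho(F\setminus K)]\subseteq U$. $\mathrm{FinBW}(\rho)$ is the class of all topological spaces $X$ such that for every $f:\Lambda\to X$ there is $F\in\mathcal{F}$ such that $f\restriction\rho(F)$ is $\rho$-convergent to some point of $X$. An almost disjoint family on a countably infinite set $\Lambda$ is a family $\mathcal{A}$ of infinite subsets of $\Lambda$ with $A\cap B$ finite for distinct $A,B\in\mathcal{A}$. For infinite such $\mathcal{A}$, $\Psi(\mathcal{A})=\Lambda\cup\mathcal{A}$ is the space in which points of $\Lambda$ are isolated and basic neighbourhoods of $A\in\mathcal{A}$ are $\{A\}\cup(A\setminus F)$ with $F$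 finite; $\Phi(\mathcal{A})=\Psi(\mathcal{A})\cup\{\infty\}$ is its Alexandroff one-point compactification. *)

theory Defs
  imports "HOL-Analysis.Analysis"
begin

unbundle cardinal_syntax

definition continuum_hypothesis :: bool where
  "continuum_hypothesis \<longleftrightarrow> |UNIV :: real set| =o cardSuc natLeq"

text \<open>
  A function \<open>\<rho> : \<F> \<rightarrow> [\<Lambda>]\<^sup>\<omega>\<close> is represented by a total function on sets whose values outside
  \<open>\<F>\<close> are irrelevant.
\<close>

locale partition_regular =
  fixes \<Lambda> :: "'a set" and \<Omega> :: "'b set" and \<F> :: "'b set set" and \<rho> :: "'b set \<Rightarrow> 'a set"
  assumes countable_\<Lambda>: "countable \<Lambda>" and infinite_\<Lambda>: "infinite \<Lambda>"
    and countable_\<Omega>: "countable \<Omega>" and infinite_\<Omega>: "infinite \<Omega>"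
    and \<F>_nonempty: "\<F> \<noteq> {}"
    and \<F>_infinite: "F \<in> \<F> \<Longrightarrow> F \<subseteq> \<Omega> \<and> infinite F"
    and \<F>_Diff: "\<lbrakk>F \<in> \<F>; finite K; K \<subseteq> \<Omega>\<rbrakk> \<Longrightarrow> F - K \<in> \<F>"
    and \<rho>_infinite: "F \<in> \<F> \<Longrightarrow> \<rho> F \<subseteq> \<Lambda> \<and> infinite (\<rho> F)"
    and M: "\<lbrakk>E \<in> \<F>; F \<in> \<F>; E \<subseteq> F\<rbrakk> \<Longrightarrow> \<rho> E \<subseteq> \<rho> F"
    and R: "\<lbrakk>F \<in> \<F>; A \<subseteq> \<Lambda>; B \<subseteq> \<Lambda>; \<rho> F = A \<union> B\<rbrakk> \<Longrightarrow> \<exists>E\<in>\<F>. \<rho> E \<subseteq> A \<or> \<rho> E \<subseteq> B"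
    and S: "F \<in> \<F> \<Longrightarrow> \<exists>E\<in>\<F>. E \<subseteq> F \<and> (\<forall>a\<in>\<rho> E. \<exists>K\<subseteq>\<Omega>. finite K \<and> a \<notin> \<rho> (E - K))"

definition ideal_of :: "'a set \<Rightarrow> 'b set set \<Rightarrow> ('b set \<Rightarrow> 'a set) \<Rightarrow> 'a set set" where
  "ideal_of \<Lambda> \<F> \<rho> = {A. A \<subseteq> \<Lambda> \<and> (\<forall>F\<in>\<F>. \<not> \<rho> F \<subseteq> A)}"

definition positive_of :: "'a set \<Rightarrow> 'b set set \<Rightarrow> ('b set \<Rightarrow> 'a set) \<Rightarrow> 'a set set" where
  "positive_of \<Lambda> \<F> \<rho> = Pow \<Lambda> - ideal_of \<Lambda> \<F> \<rho>"

definition P_minus :: "'a set \<Rightarrow> 'b set \<Rightarrow> 'b set set \<Rightarrow> ('b set \<Rightarrow> 'a set) \<Rightarrow> bool" where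
  "P_minus \<Lambda> \<Omega> \<F> \<rho> \<longleftrightarrow>
    (\<forall>A :: nat \<Rightarrow> 'a set.
      (\<forall>n. A n \<in> positive_of \<Lambda> \<F> \<rho>) \<and> (\<forall>n. A (Suc n) \<subseteq> A n) \<and>
      (\<forall>n. A n - A (Suc n) \<in> ideal_of \<Lambda> \<F> \<rho>) \<longrightarrow>
      (\<exists>F\<in>\<F>. \<forall>n. \<exists>K\<subseteq>\<Omega>. finite K \<and> \<rho> (F - K) \<subseteq> A n))"

text \<open>\<open>katetov_le \<Lambda>2 I2 \<Lambda>1 I1\<close> means \<open>I2 \<le>\<^sub>K I1\<close> for ideals \<open>I2\<close> on \<open>\<Lambda>2\<close> and \<open>I1\<close> on \<open>\<Lambda>1\<close>.\<close>

definition katetov_le :: "'c set \<Rightarrow> 'c set set \<Rightarrow> 'a set \<Rightarrow> 'a set set \<Rightarrow> bool" where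
  "katetov_le \<Lambda>2 I2 \<Lambda>1 I1 \<longleftrightarrow>
    (\<exists>\<phi> \<in> \<Lambda>1 \<rightarrow> \<Lambda>2. \<forall>A. A \<subseteq> \<Lambda>1 \<and> A \<notin> I1 \<longrightarrow> \<phi> ` A \<notin> I2)"

definition rho_convergent ::
    "'b set \<Rightarrow> ('b set \<Rightarrow> 'a set) \<Rightarrow> 'b set \<Rightarrow> 'x topology \<Rightarrow> ('a \<Rightarrow> 'x) \<Rightarrow> 'x \<Rightarrow> bool" where
  "rho_convergent \<Omega> \<rho> F X f x \<longleftrightarrow>
    x \<in> topspace X \<and>
    (\<forall>U. openin X U \<and> x \<in> U \<longrightarrow> (\<exists>K\<subseteq>\<Omega>. finite K \<and> f ` \<rho> (F - K) \<subseteq> U))"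

definition FinBW ::
    "'a set \<Rightarrow> 'b set \<Rightarrow> 'b set set \<Rightarrow> ('b set \<Rightarrow> 'a set) \<Rightarrow> 'x topology \<Rightarrow> bool" where
  "FinBW \<Lambda> \<Omega> \<F> \<rho> X \<longleftrightarrow>
    (\<forall>f \<in> \<Lambda> \<rightarrow> topspace X. \<exists>F\<in>\<F>. \<exists>x. rho_convergent \<Omega> \<rho> F X f x)"

definition almost_disjoint_family :: "'a set \<Rightarrow> 'a set set \<Rightarrow> bool" where
  "almost_disjoint_family \<Lambda> \<A> \<longleftrightarrow>
    (\<forall>A\<in>\<A>. A \<subseteq> \<Lambda> \<and> infinite A) \<and> (\<forall>A\<in>\<A>. \<forall>B\<in>\<A>. A \<noteq> B \<longrightarrow> finite (A \<inter> B))"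

text \<open>
  The generating sets form a base when \<open>\<A>\<close> is almost disjoint: the intersection of basic
  neighbourhoods of distinct \<open>A, B \<in> \<A>\<close> consists of isolated points.
\<close>

definition Psi_space :: "'a set \<Rightarrow> 'a set set \<Rightarrow> ('a + 'a set) topology" where
  "Psi_space \<Lambda> \<A> = topology_generated_by
    ({{Inl n} |n. n \<in> \<Lambda>} \<union> {{Inr A} \<union> Inl ` (A - F) |A F. A \<in> \<A> \<and> finite F})"

definition Phi_space :: "'a set \<Rightarrow> 'a set set \<Rightarrow> ('a + 'a set) option topology" where
  "Phi_space \<Lambda> \<A> = Alexandroff_compactification (Psi_space \<Lambda> \<A>)"

end

theory Submission
  imports Defs "HOL-Library.Countable_Set_Type"
begin

text \<open>
  Identify \<open>\<Lambda>\<^sub>2\<close> with \<open>\<omega>\<close>. Since \<open>\<I>\<^sub>\<rho>\<^sub>2\<close> is not Katetov below \<open>\<I>\<^sub>\<rho>\<^sub>1\<close>, it is tall: otherwise an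
  injection of \<open>\<Lambda>\<^sub>1\<close> into a set all of whose infinite subsets are positive would be a reduction.
  By CH, sets \<open>A\<^sub>\<alpha>, C\<^sub>\<alpha> \<in> \<I>\<^sub>\<rho>\<^sub>2\<close> are chosen by recursion along \<open>\<omega>\<^sub>1\<close>, where stage \<open>\<alpha>\<close> deals with
  a set \<open>F \<in> \<F>\<^sub>2\<close> and a function \<open>f\<close> on \<open>\<Lambda>\<^sub>1\<close>, and only countably many sets precede it.
  If \<open>f\<close> has no positive fibre and no earlier \<open>A\<^sub>\<beta>\<close> has a positive preimage, the failure of the Katetov
  reduction gives a positive set with image in the ideal, and \<open>P\<^sup>-\<close> refines it to a restriction
  of \<open>f\<close> that leaves every finite set and every earlier \<open>A\<^sub>\<beta>\<close>, with image inside a set \<open>C\<^sub>\<alpha>\<close>.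
  Then \<open>A\<^sub>\<alpha>\<close> is chosen almost disjoint from all earlier \<open>A\<^sub>\<beta>\<close> and from all \<open>C\<^sub>\<beta>\<close> with \<open>\<beta> \<le> \<alpha>\<close>, and
  meeting \<open>\<rho>\<^sub>2(F - K)\<close> for every finite \<open>K\<close>: pick points of \<open>\<rho>\<^sub>2(F - K\<^sub>n)\<close> outside finitely many sets
  of the ideal and thin out by tallness. The inclusion of \<open>\<Lambda>\<^sub>2\<close> thus has no \<open>\<rho>\<^sub>2\<close>-convergent
  restriction, whereas the restriction of \<open>f\<close> converges to \<open>\<infinity>\<close>.
\<close>

section \<open>Mrowka spaces and their one-point compactifications\<close>

text \<open>The condition on the right holds for the generators and survives finite intersections
  and arbitrary unions. Conversely, a set satisfying it contains a generator around each of its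
  points. All later topology goes through this description.\<close>

lemma openin_Psi_space:
  assumes "\<And>A. A \<in> \<A> \<Longrightarrow> A \<subseteq> \<Lambda>"
  shows "openin (Psi_space \<Lambda> \<A>) U \<longleftrightarrow>
    U \<subseteq> Inl ` \<Lambda> \<union> Inr ` \<A> \<and> (\<forall>A. Inr A \<in> U \<longrightarrow> finite {n \<in> A. Inl n \<notin> U})"
    (is "?L \<longleftrightarrow> ?R")
proof
  let ?G = "{{Inl n} |n. n \<in> \<Lambda>} \<union> {{Inr A} \<union> Inl ` (A - F) |A F. A \<in> \<A> \<and> finite F}"
  assume ?L
  then have "generate_topology_on ?G U"
    by (simp add: Psi_space_def openin_topology_generated_by_iff)
  then show ?R
  proof induction
    case Empty
    show ?case by simp
  next
    case (Int a b)
    have "finite {n \<in> A. Inl n \<notin> a \<inter> b}" if "Inr A \<in> a \<inter> b" for A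
      by (rule finite_subset[of _ "{n \<in> A. Inl n \<notin> a} \<union> {n \<in> A. Inl n \<notin> b}"])
        (use Int.IH that in auto)
    moreover have "a \<inter> b \<subseteq> Inl ` \<Lambda> \<union> Inr ` \<A>" using Int by blast
    ultimately show ?case by simp
  next
    case (UN K)
    have "finite {n \<in> A. Inl n \<notin> \<Union>K}" if "Inr A \<in> \<Union>K" for A
    proof -
      from that obtain k where "k \<in> K" "Inr A \<in> k" by blast
      then have "finite {n \<in> A. Inl n \<notin> k}" using UN.IH by simp
      then show ?thesis by (rule rev_finite_subset) (use \<open>k \<in> K\<close> in blast)
    qed
    moreover have "\<Union>K \<subseteq> Inl ` \<Lambda> \<union> Inr ` \<A>" using UN.IH by simp blast
    ultimately show ?case by simp
  next
    case (Basis s)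
    then consider n where "n \<in> \<Lambda>" "s = {Inl n}"
      | A F where "A \<in> \<A>" "finite F" "s = {Inr A} \<union> Inl ` (A - F)"
      by blast
    then show ?case
    proof cases
      case 2
      then have "{n \<in> A. Inl n \<notin> s} \<subseteq> F" by auto
      with 2 assms show ?thesis by (auto dest: finite_subset)
    qed auto
  qed
next
  let ?P = "Psi_space \<Lambda> \<A>"
  assume R: ?R
  have n: "openin ?P {Inl n}" if "n \<in> \<Lambda>" for n
    unfolding Psi_space_def by (rule topology_generated_by_Basis) (use that in blast)
  have A: "openin ?P ({Inr A} \<union> Inl ` (A - F))" if "A \<in> \<A>" "finite F" for A F
    unfolding Psi_space_def by (rule topology_generated_by_Basis) (use that in blast)
  have "\<exists>V. openin ?P V \<and> x \<in> V \<and> V \<subseteq> U" if "x \<in> U" for x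
  proof (cases x)
    case (Inl a)
    with that R have "a \<in> \<Lambda>" by blast
    with that Inl n show ?thesis by (intro exI[of _ "{Inl a}"]) simp
  next
    case (Inr B)
    then have "B \<in> \<A>" using that R by blast
    then show ?thesis
      using that Inr R A[of B "{n \<in> B. Inl n \<notin> U}"]
      by (intro exI[of _ "{Inr B} \<union> Inl ` (B - {n \<in> B. Inl n \<notin> U})"]) auto
  qed
  then show ?L using openin_subopen[of ?P U] by simp
qed

text \<open>The largest basic neighbourhood of each point. These sets turn out to be compact and
  clopen, so finite unions of them can replace arbitrary compact sets.\<close>

fun Psi_nbhd :: "'a + 'a set \<Rightarrow> ('a + 'a set) set" where
  "Psi_nbhd (Inl n) = {Inl n}"
| "Psi_nbhd (Inr A) = insert (Inr A) (Inl ` A)"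

lemma Psi_nbhd_self: "x \<in> Psi_nbhd x"
  by (cases x) auto

locale mrowka =
  fixes \<Lambda> :: "'a set" and \<A> :: "'a set set"
  assumes adf: "almost_disjoint_family \<Lambda> \<A>"
begin

lemma member_subset: "A \<in> \<A> \<Longrightarrow> A \<subseteq> \<Lambda>"
  using adf by (auto simp: almost_disjoint_family_def)

lemma member_finite_Int: "A \<in> \<A> \<Longrightarrow> B \<in> \<A> \<Longrightarrow> A \<noteq> B \<Longrightarrow> finite (A \<inter> B)"
  using adf by (auto simp: almost_disjoint_family_def)

lemma openin_Psi:
  "openin (Psi_space \<Lambda> \<A>) U \<longleftrightarrow>
    U \<subseteq> Inl ` \<Lambda> \<union> Inr ` \<A> \<and> (\<forall>A. Inr A \<in> U \<longrightarrow> finite {n \<in> A. Inl n \<notin> U})"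
  by (rule openin_Psi_space) (rule member_subset)

lemma topspace_Psi: "topspace (Psi_space \<Lambda> \<A>) = Inl ` \<Lambda> \<union> Inr ` \<A>"
proof (rule subset_antisym)
  have "openin (Psi_space \<Lambda> \<A>) (topspace (Psi_space \<Lambda> \<A>))" by simp
  then show "topspace (Psi_space \<Lambda> \<A>) \<subseteq> Inl ` \<Lambda> \<union> Inr ` \<A>"
    unfolding openin_Psi by blast
  have "openin (Psi_space \<Lambda> \<A>) (Inl ` \<Lambda> \<union> Inr ` \<A>)"
  proof -
    have "{n \<in> A. Inl n \<notin> Inl ` \<Lambda> \<union> Inr ` \<A>} = {}" if "A \<in> \<A>" for A
      using member_subset[OF that] by auto
    then have "finite {n \<in> A. Inl n \<notin> Inl ` \<Lambda> \<union> Inr ` \<A>}" if "A \<in> \<A>" for A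
      using that by (metis finite.emptyI)
    then show ?thesis unfolding openin_Psi by blast
  qed
  then show "Inl ` \<Lambda> \<union> Inr ` \<A> \<subseteq> topspace (Psi_space \<Lambda> \<A>)"
    by (rule openin_subset)
qed

lemma openin_Psi_nbhd:
  assumes "x \<in> topspace (Psi_space \<Lambda> \<A>)"
  shows "openin (Psi_space \<Lambda> \<A>) (Psi_nbhd x)"
proof (cases x)
  case (Inl n)
  with assms show ?thesis unfolding openin_Psi by (auto simp: topspace_Psi)
next
  case (Inr A)
  then have A: "A \<in> \<A>" using assms by (auto simp: topspace_Psi)
  have "{n \<in> A. Inl n \<notin> Psi_nbhd x} = {}" using Inr by auto
  then have "finite {n \<in> A. Inl n \<notin> Psi_nbhd x}" by (metis finite.emptyI)
  moreover have "B = A" if "Inr B \<in> Psi_nbhd x" for B using that Inr by auto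
  moreover have "Psi_nbhd x \<subseteq> Inl ` \<Lambda> \<union> Inr ` \<A>" using Inr A member_subset[OF A] by auto
  ultimately show ?thesis unfolding openin_Psi by blast
qed

lemma compactin_Psi_nbhd:
  assumes "x \<in> topspace (Psi_space \<Lambda> \<A>)"
  shows "compactin (Psi_space \<Lambda> \<A>) (Psi_nbhd x)"
proof (cases x)
  case (Inl n)
  with assms show ?thesis by (simp add: finite_imp_compactin)
next
  case (Inr A)
  show ?thesis unfolding compactin_def
  proof (intro conjI allI impI)
    show "Psi_nbhd x \<subseteq> topspace (Psi_space \<Lambda> \<A>)"
      using openin_Psi_nbhd[OF assms] by (rule openin_subset)
    fix \<U> assume U: "Ball \<U> (openin (Psi_space \<Lambda> \<A>)) \<and> Psi_nbhd x \<subseteq> \<Union>\<U>"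
    then obtain V where V: "V \<in> \<U>" "Inr A \<in> V" using Inr by auto
    then have fin: "finite {n \<in> A. Inl n \<notin> V}" using U openin_Psi by blast
    have "\<forall>n\<in>A. \<exists>W\<in>\<U>. Inl n \<in> W" using U Inr by auto
    then obtain W where W: "\<And>n. n \<in> A \<Longrightarrow> W n \<in> \<U> \<and> Inl n \<in> W n" by metis
    \<comment> \<open>The cover member \<open>V\<close> around \<open>Inr A\<close> contains all but
      finitely many points of \<open>A\<close>; each of the missing ones gets its own
      \<open>W n\<close>.\<close>
    let ?F = "insert V (W ` {n \<in> A. Inl n \<notin> V})"
    have "finite ?F" "?F \<subseteq> \<U>" using fin V W by auto
    moreover have "Psi_nbhd x \<subseteq> \<Union>?F" using Inr V W by auto
    ultimately show "\<exists>\<F>. finite \<F> \<and> \<F> \<subseteq> \<U> \<and> Psi_nbhd x \<subseteq> \<Union>\<F>" by blast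
  qed
qed

text \<open>This is where almost disjointness enters: another member \<open>B\<close> meets
  \<open>A\<close> in a finite set, so almost all of \<open>B\<close> stays in the
  complement.\<close>

lemma closedin_Psi_nbhd:
  assumes "x \<in> topspace (Psi_space \<Lambda> \<A>)"
  shows "closedin (Psi_space \<Lambda> \<A>) (Psi_nbhd x)"
proof -
  let ?T = "Inl ` \<Lambda> \<union> Inr ` \<A>"
  have "finite {n \<in> B. Inl n \<notin> ?T - Psi_nbhd x}" if B: "Inr B \<in> ?T - Psi_nbhd x" for B
  proof (cases x)
    case (Inl n)
    then have "{n \<in> B. Inl n \<notin> ?T - Psi_nbhd x} \<subseteq> {n}" using B member_subset by auto
    then show ?thesis by (rule finite_subset) simp
  next
    case (Inr A)
    then have "{n \<in> B. Inl n \<notin> ?T - Psi_nbhd x} \<subseteq> A \<inter> B" using B member_subset by auto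
    moreover have "finite (A \<inter> B)"
      using B Inr assms by (intro member_finite_Int) (auto simp: topspace_Psi)
    ultimately show ?thesis by (rule finite_subset)
  qed
  then have "openin (Psi_space \<Lambda> \<A>) (?T - Psi_nbhd x)" unfolding openin_Psi by blast
  then show ?thesis
    using openin_subset[OF openin_Psi_nbhd[OF assms]] by (simp add: closedin_def topspace_Psi)
qed

lemma compactin_Psi_cover:
  assumes "compactin (Psi_space \<Lambda> \<A>) C"
  obtains D where "finite D" "D \<subseteq> C" "C \<subseteq> (\<Union>x\<in>D. Psi_nbhd x)"
proof -
  have "\<exists>\<G>. finite \<G> \<and> \<G> \<subseteq> Psi_nbhd ` C \<and> C \<subseteq> \<Union>\<G>"
    using assms compactin_subset_topspace[OF assms] openin_Psi_nbhd Psi_nbhd_self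
    by (intro compactinD) auto
  then obtain \<G> where "finite \<G>" "\<G> \<subseteq> Psi_nbhd ` C" "C \<subseteq> \<Union>\<G>" by blast
  moreover then obtain D where "finite D" "D \<subseteq> C" "\<G> = Psi_nbhd ` D"
    by (meson finite_subset_image)
  ultimately show ?thesis using that by blast
qed

lemma Hausdorff_space_Psi: "Hausdorff_space (Psi_space \<Lambda> \<A>)"
  unfolding Hausdorff_space_def
proof (intro allI impI)
  let ?P = "Psi_space \<Lambda> \<A>"
  fix x y assume xy: "x \<in> topspace ?P \<and> y \<in> topspace ?P \<and> x \<noteq> y"
  \<comment> \<open>A neighbourhood \<open>Psi_nbhd\<close> contains, besides its centre, only
    isolated points. One clopen neighbourhood and its complement therefore separate the two
    points.\<close>
  have "x \<notin> Psi_nbhd y \<or> y \<notin> Psi_nbhd x"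
    using xy by (cases x; cases y) auto
  moreover have "openin ?P (topspace ?P - Psi_nbhd z)" if "z \<in> topspace ?P" for z
    using closedin_Psi_nbhd[OF that] by blast
  ultimately show "\<exists>U V. openin ?P U \<and> openin ?P V \<and> x \<in> U \<and> y \<in> V \<and> disjnt U V"
    using xy openin_Psi_nbhd Psi_nbhd_self unfolding disjnt_def
    by (metis DiffI Diff_disjoint inf_commute)
qed

lemma locally_compact_space_Psi: "locally_compact_space (Psi_space \<Lambda> \<A>)"
  unfolding locally_compact_space_def
  using openin_Psi_nbhd compactin_Psi_nbhd Psi_nbhd_self by blast

section \<open>The compactification: neighbourhoods, separation and separability\<close>

lemma topspace_Phi: "topspace (Phi_space \<Lambda> \<A>) = insert None (Some ` (Inl ` \<Lambda> \<union> Inr ` \<A>))"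
  by (simp add: Phi_space_def topspace_Psi)

lemma Hausdorff_space_Phi: "Hausdorff_space (Phi_space \<Lambda> \<A>)"
  unfolding Phi_space_def Hausdorff_space_Alexandroff_compactification
  using Hausdorff_space_Psi locally_compact_space_Psi by blast

lemma compact_space_Phi: "compact_space (Phi_space \<Lambda> \<A>)"
  by (simp add: Phi_space_def)

lemma openin_Phi_Some: "openin (Phi_space \<Lambda> \<A>) (Some ` U) \<longleftrightarrow> openin (Psi_space \<Lambda> \<A>) U"
  by (simp add: Phi_space_def)

lemma openin_Phi_Compl_nbhd:
  assumes "x \<in> topspace (Psi_space \<Lambda> \<A>)"
  shows "openin (Phi_space \<Lambda> \<A>) (insert None (Some ` (topspace (Psi_space \<Lambda> \<A>) - Psi_nbhd x)))"
  unfolding Phi_space_def openin_Alexandroff_compactification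
  using compactin_Psi_nbhd[OF assms] closedin_Psi_nbhd[OF assms] by blast

lemma openin_Phi_SomeE:
  assumes "openin (Phi_space \<Lambda> \<A>) U" "Some x \<in> U"
  obtains V where "openin (Psi_space \<Lambda> \<A>) V" "x \<in> V" "Some ` V \<subseteq> U"
proof -
  have "openin (Psi_space \<Lambda> \<A>) {x \<in> topspace (Psi_space \<Lambda> \<A>). Some x \<in> U}"
    using continuous_map_Some assms(1) openin_continuous_map_preimage
    unfolding Phi_space_def by blast
  moreover have "Some x \<in> topspace (Phi_space \<Lambda> \<A>)"
    using assms openin_subset by blast
  ultimately show ?thesis
    using assms by (intro that) (auto simp: Phi_space_def)
qed

text \<open>The compact complement of a neighbourhood of infinity is covered by finitely many
  \<open>Psi_nbhd\<close>, so convergence to infinity need only be tested against these.\<close>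

lemma openin_Phi_NoneE:
  assumes "openin (Phi_space \<Lambda> \<A>) U" "None \<in> U"
  obtains D where "finite D" "D \<subseteq> topspace (Psi_space \<Lambda> \<A>)"
    "topspace (Phi_space \<Lambda> \<A>) - (\<Union>x\<in>D. Some ` Psi_nbhd x) \<subseteq> U"
proof -
  obtain C where C: "compactin (Psi_space \<Lambda> \<A>) C"
    and U: "U = insert None (Some ` (topspace (Psi_space \<Lambda> \<A>) - C))"
    using assms unfolding Phi_space_def openin_Alexandroff_compactification by blast
  obtain D where D: "finite D" "D \<subseteq> C" "C \<subseteq> (\<Union>x\<in>D. Psi_nbhd x)"
    using compactin_Psi_cover[OF C] by blast
  show ?thesis
  proof
    show "finite D" by fact
    show "D \<subseteq> topspace (Psi_space \<Lambda> \<A>)"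
      using D(2) compactin_subset_topspace[OF C] by blast
    show "topspace (Phi_space \<Lambda> \<A>) - (\<Union>x\<in>D. Some ` Psi_nbhd x) \<subseteq> U"
      using D(3) by (auto simp: U Phi_space_def)
  qed
qed

lemma separable_space_Phi:
  assumes "countable \<Lambda>" and "\<And>A. A \<in> \<A> \<Longrightarrow> infinite A"
  shows "separable_space (Phi_space \<Lambda> \<A>)"
proof -
  \<comment> \<open>Infinity is put into the dense set directly, so that only the points of
    \<open>\<A>\<close> remain to be approximated; this works because each member is
    infinite.\<close>
  let ?C = "insert None (Some ` Inl ` \<Lambda>)"
  have "\<exists>y \<in> ?C. y \<in> U" if U: "openin (Phi_space \<Lambda> \<A>) U" "x \<in> U" for x U
  proof -
    have "x \<in> topspace (Phi_space \<Lambda> \<A>)" using U openin_subset by blast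
    then consider "x \<in> ?C" | A where "x = Some (Inr A)" "A \<in> \<A>" by (auto simp: topspace_Phi)
    then show ?thesis
    proof cases
      case 2
      then obtain V where V: "openin (Psi_space \<Lambda> \<A>) V" "Inr A \<in> V" "Some ` V \<subseteq> U"
        using openin_Phi_SomeE U by blast
      then have "finite {n \<in> A. Inl n \<notin> V}" using openin_Psi by blast
      moreover have "infinite A" using assms(2) 2 by blast
      ultimately obtain n where "n \<in> A" "Inl n \<in> V"
        by (metis (mono_tags, lifting) mem_Collect_eq rev_finite_subset subsetI)
      then show ?thesis using V member_subset[OF 2(2)] by blast
    qed (use U in blast)
  qed
  then have "Phi_space \<Lambda> \<A> closure_of ?C = topspace (Phi_space \<Lambda> \<A>)"
    unfolding closure_of_def by auto
  moreover have "?C \<subseteq> topspace (Phi_space \<Lambda> \<A>)" by (auto simp: topspace_Phi)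
  moreover have "countable ?C" using assms by simp
  ultimately show ?thesis unfolding separable_space_def by blast
qed

end

section \<open>Partition regular functions\<close>

context partition_regular
begin

abbreviation "\<I> \<equiv> ideal_of \<Lambda> \<F> \<rho>"

text \<open>Some tail of \<open>F\<close>, that is \<open>F - K\<close> with \<open>K\<close>
  finite, has its \<open>\<rho>\<close>-value disjoint from \<open>Z\<close>. Convergence to
  infinity becomes avoidance of the preimages of compact sets.\<close>

definition avoids :: "'b set \<Rightarrow> 'a set \<Rightarrow> bool" where
  "avoids F Z \<longleftrightarrow> (\<exists>K\<subseteq>\<Omega>. finite K \<and> \<rho> (F - K) \<inter> Z = {})"

lemma ideal_subset: "A \<in> \<I> \<Longrightarrow> B \<subseteq> A \<Longrightarrow> B \<in> \<I>"
  unfolding ideal_of_def by blast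

lemma ideal_Un:
  assumes "A \<in> \<I>" "B \<in> \<I>"
  shows "A \<union> B \<in> \<I>"
proof -
  have False if "F \<in> \<F>" "\<rho> F \<subseteq> A \<union> B" for F
  proof -
    have "\<rho> F = (\<rho> F \<inter> A) \<union> (\<rho> F \<inter> B)" using that by blast
    then obtain E where "E \<in> \<F>" "\<rho> E \<subseteq> \<rho> F \<inter> A \<or> \<rho> E \<subseteq> \<rho> F \<inter> B"
      using R[OF \<open>F \<in> \<F>\<close>, of "\<rho> F \<inter> A" "\<rho> F \<inter> B"] \<rho>_infinite[OF \<open>F \<in> \<F>\<close>] by blast
    then show False using assms by (auto simp: ideal_of_def)
  qed
  then show ?thesis using assms by (auto simp: ideal_of_def)
qed

lemma ideal_finite: "finite A \<Longrightarrow> A \<subseteq> \<Lambda> \<Longrightarrow> A \<in> \<I>"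
  unfolding ideal_of_def using \<rho>_infinite finite_subset by blast

lemma ideal_UN: "finite J \<Longrightarrow> (\<And>j. j \<in> J \<Longrightarrow> A j \<in> \<I>) \<Longrightarrow> (\<Union>j\<in>J. A j) \<in> \<I>"
  by (induction rule: finite_induct) (auto intro: ideal_Un simp: ideal_finite)

lemma positiveE:
  assumes "A \<notin> \<I>" "A \<subseteq> \<Lambda>"
  obtains F where "F \<in> \<F>" "\<rho> F \<subseteq> A"
  using assms by (auto simp: ideal_of_def)

lemma \<rho>_Diff_mono:
  assumes "F \<in> \<F>" "finite K" "K \<subseteq> \<Omega>" "finite L" "L \<subseteq> \<Omega>" "K \<subseteq> L"
  shows "\<rho> (F - L) \<subseteq> \<rho> (F - K)"
  using assms by (intro M \<F>_Diff) auto

lemma \<rho>_Diff_subset: "F \<in> \<F> \<Longrightarrow> finite K \<Longrightarrow> K \<subseteq> \<Omega> \<Longrightarrow> \<rho> (F - K) \<subseteq> \<rho> F"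
  using \<rho>_Diff_mono[of F "{}" K] by simp

lemma avoids_mono:
  assumes "F \<in> \<F>" "avoids F Z" "\<rho> F \<inter> Y \<subseteq> Z"
  shows "avoids F Y"
proof -
  obtain K where K: "K \<subseteq> \<Omega>" "finite K" "\<rho> (F - K) \<inter> Z = {}"
    using assms(2) unfolding avoids_def by blast
  then have "\<rho> (F - K) \<inter> Y = {}" using \<rho>_Diff_subset[OF assms(1) K(2,1)] assms(3) by blast
  with K show ?thesis unfolding avoids_def by blast
qed

lemma avoids_UN:
  assumes "F \<in> \<F>" "finite J" "\<And>j. j \<in> J \<Longrightarrow> avoids F (Z j)"
  shows "avoids F (\<Union>j\<in>J. Z j)"
proof -
  obtain K where K: "\<And>j. j \<in> J \<Longrightarrow> K j \<subseteq> \<Omega> \<and> finite (K j) \<and> \<rho> (F - K j) \<inter> Z j = {}"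
    using assms(3) unfolding avoids_def by metis
  have "\<rho> (F - (\<Union>j\<in>J. K j)) \<subseteq> \<rho> (F - K j)" if "j \<in> J" for j
    using that K assms by (intro \<rho>_Diff_mono) auto
  then have "\<rho> (F - (\<Union>j\<in>J. K j)) \<inter> (\<Union>j\<in>J. Z j) = {}" using K by blast
  then show ?thesis unfolding avoids_def using K assms(2)
    by (intro exI[of _ "\<Union>j\<in>J. K j"]) blast
qed

text \<open>Removing the members of \<open>\<Z>\<close> from \<open>B\<close> one after another
  keeps the set positive and changes it each time by a set in the ideal. So \<open>P_minus\<close>
  gives one \<open>F\<close> with tails inside all the remainders.\<close>

lemma P_minus_avoids:
  assumes P: "P_minus \<Lambda> \<Omega> \<F> \<rho>" and B: "B \<subseteq> \<Lambda>" "B \<notin> \<I>"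
    and Z: "countable \<Z>" "\<Z> \<subseteq> \<I>"
  shows "\<exists>F\<in>\<F>. \<rho> F \<subseteq> B \<and> (\<forall>Z\<in>\<Z>. avoids F Z)"
proof -
  have "{} \<in> \<I>" by (simp add: ideal_finite)
  \<comment> \<open>The extra empty set makes the enumeration meaningful also for empty
    \<open>\<Z>\<close>.\<close>
  define z where "z = from_nat_into (insert {} \<Z>)"
  have z: "z n \<in> \<I>" for n
    using from_nat_into[of "insert {} \<Z>" n] Z(2) \<open>{} \<in> \<I>\<close> unfolding z_def by auto
  define A where "A n = B - (\<Union>i<n. z i)" for n
  have zs: "(\<Union>i<n. z i) \<in> \<I>" for n using z by (intro ideal_UN) auto
  have "A n \<in> positive_of \<Lambda> \<F> \<rho>" for n
  proof -
    have "A n \<notin> \<I>"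
    proof
      assume "A n \<in> \<I>"
      then have "A n \<union> (\<Union>i<n. z i) \<in> \<I>" using zs ideal_Un by blast
      then have "B \<in> \<I>" by (rule ideal_subset) (auto simp: A_def)
      with B show False by simp
    qed
    then show ?thesis using B by (auto simp: positive_of_def A_def)
  qed
  moreover have "A (Suc n) \<subseteq> A n" for n by (auto simp: A_def)
  moreover have "A n - A (Suc n) \<in> \<I>" for n
    by (rule ideal_subset[OF z[of n]]) (auto simp: A_def less_Suc_eq)
  ultimately obtain F where F: "F \<in> \<F>" and *: "\<And>n. \<exists>K\<subseteq>\<Omega>. finite K \<and> \<rho> (F - K) \<subseteq> A n"
    using P[unfolded P_minus_def, rule_format, of A] by auto
  \<comment> \<open>Only tails of \<open>F\<close> are known to go into \<open>B = A 0\<close>, so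
    \<open>F\<close> is replaced by such a tail.\<close>
  obtain K where K: "K \<subseteq> \<Omega>" "finite K" "\<rho> (F - K) \<subseteq> A 0" using * by blast
  have FK: "F - K \<in> \<F>" using K F \<F>_Diff by blast
  show ?thesis
  proof (intro bexI[OF _ FK] conjI ballI)
    show "\<rho> (F - K) \<subseteq> B" using K by (auto simp: A_def)
    fix Z assume "Z \<in> \<Z>"
    then obtain n where n: "Z = z n"
      using Z(1) from_nat_into_surj[of "insert {} \<Z>" Z] unfolding z_def by auto
    \<comment> \<open>The index is \<open>Suc n\<close> because \<open>A n\<close> omits only the
      \<open>z i\<close> with \<open>i < n\<close>.\<close>
    obtain L where L: "L \<subseteq> \<Omega>" "finite L" "\<rho> (F - L) \<subseteq> A (Suc n)" using * by blast
    have "\<rho> (F - K - L) \<subseteq> \<rho> (F - L)"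
      using FK F K L by (intro M \<F>_Diff) auto
    then have "\<rho> (F - K - L) \<inter> Z = {}" using L n by (auto simp: A_def)
    then show "avoids (F - K) Z" using L by (auto simp: avoids_def)
  qed
qed

section \<open>Criteria for convergence to a point, to infinity and to a member of the
  family\<close>

lemma rho_convergent_constant:
  assumes "F \<in> \<F>" "\<And>a. a \<in> \<rho> F \<Longrightarrow> f a = x" "x \<in> topspace X"
  shows "rho_convergent \<Omega> \<rho> F X f x"
  unfolding rho_convergent_def using assms by (auto intro!: exI[of _ "{}"])

lemma rho_convergent_infinity:
  assumes "mrowka \<Delta> \<A>" and F: "F \<in> \<F>" and f: "f \<in> \<Lambda> \<rightarrow> topspace (Phi_space \<Delta> \<A>)"
    and av: "\<And>x. x \<in> Inl ` \<Delta> \<union> Inr ` \<A> \<Longrightarrow> avoids F {a. f a \<in> Some ` Psi_nbhd x}"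
  shows "rho_convergent \<Omega> \<rho> F (Phi_space \<Delta> \<A>) f None"
proof -
  interpret mrowka \<Delta> \<A> by fact
  have "\<exists>K\<subseteq>\<Omega>. finite K \<and> f ` \<rho> (F - K) \<subseteq> U"
    if U: "openin (Phi_space \<Delta> \<A>) U" "None \<in> U" for U
  proof -
    obtain D where D: "finite D" "D \<subseteq> topspace (Psi_space \<Delta> \<A>)"
      and DU: "topspace (Phi_space \<Delta> \<A>) - (\<Union>x\<in>D. Some ` Psi_nbhd x) \<subseteq> U"
      using openin_Phi_NoneE[OF U] by blast
    have "avoids F (\<Union>x\<in>D. {a. f a \<in> Some ` Psi_nbhd x})"
      using D by (intro avoids_UN F av) (auto simp: topspace_Psi)
    then obtain K where K: "K \<subseteq> \<Omega>" "finite K"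
      "\<rho> (F - K) \<inter> (\<Union>x\<in>D. {a. f a \<in> Some ` Psi_nbhd x}) = {}"
      unfolding avoids_def by blast
    have "\<rho> (F - K) \<subseteq> \<Lambda>" using \<rho>_infinite \<F>_Diff F K by blast
    have "f a \<in> U" if "a \<in> \<rho> (F - K)" for a
    proof -
      have "f a \<in> topspace (Phi_space \<Delta> \<A>)" using that \<open>\<rho> (F - K) \<subseteq> \<Lambda>\<close> f by blast
      moreover have "f a \<notin> (\<Union>x\<in>D. Some ` Psi_nbhd x)" using that K(3) by auto
      ultimately show ?thesis using DU by blast
    qed
    with K show ?thesis by blast
  qed
  then show ?thesis by (simp add: rho_convergent_def topspace_Phi)
qed

text \<open>A neighbourhood of \<open>Inr A\<close> misses only finitely many points of
  \<open>A\<close>, and a common tail of \<open>F\<close> avoids the fibres over all of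
  them.\<close>

lemma rho_convergent_member:
  assumes "mrowka \<Delta> \<A>" and F: "F \<in> \<F>" and A: "A \<in> \<A>"
    and f: "\<And>a. a \<in> \<rho> F \<Longrightarrow> f a \<in> Some ` Inl ` A"
    and av: "\<And>n. avoids F {a \<in> \<Lambda>. f a = Some (Inl n)}"
  shows "rho_convergent \<Omega> \<rho> F (Phi_space \<Delta> \<A>) f (Some (Inr A))"
proof -
  interpret mrowka \<Delta> \<A> by fact
  have "\<exists>K\<subseteq>\<Omega>. finite K \<and> f ` \<rho> (F - K) \<subseteq> U"
    if U: "openin (Phi_space \<Delta> \<A>) U" "Some (Inr A) \<in> U" for U
  proof -
    obtain V where V: "openin (Psi_space \<Delta> \<A>) V" "Inr A \<in> V" "Some ` V \<subseteq> U"
      using openin_Phi_SomeE[OF U] by blast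
    then have "finite {n \<in> A. Inl n \<notin> V}" using openin_Psi by blast
    then have "avoids F (\<Union>n\<in>{n \<in> A. Inl n \<notin> V}. {a \<in> \<Lambda>. f a = Some (Inl n)})"
      by (intro avoids_UN F av)
    then obtain K where K: "K \<subseteq> \<Omega>" "finite K"
      "\<rho> (F - K) \<inter> (\<Union>n\<in>{n \<in> A. Inl n \<notin> V}. {a \<in> \<Lambda>. f a = Some (Inl n)}) = {}"
      unfolding avoids_def by blast
    have "f a \<in> U" if "a \<in> \<rho> (F - K)" for a
    proof -
      have "a \<in> \<rho> F" using that \<rho>_Diff_subset[OF F K(2,1)] by blast
      moreover have "a \<in> \<Lambda>" using \<open>a \<in> \<rho> F\<close> \<rho>_infinite[OF F] by blast
      ultimately obtain n where "n \<in> A" "f a = Some (Inl n)" using f by blast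
      then show ?thesis using K(3) that V(3) \<open>a \<in> \<Lambda>\<close> by blast
    qed
    with K show ?thesis by blast
  qed
  then show ?thesis using A by (simp add: rho_convergent_def topspace_Phi)
qed

end

section \<open>The transfinite construction\<close>

context partition_regular
begin

text \<open>
  Whatever \<open>f : \<Lambda> \<rightarrow> \<omega> \<union> {\<infinity>}\<close> is (with \<open>None\<close> for \<open>\<infinity>\<close>), the first three alternatives give a
  \<open>\<rho>\<close>-convergent restriction to a constant or to a member of \<open>\<A>\<close>; in the last one a restriction
  converges to \<open>\<infinity>\<close>, and it keeps doing so when \<open>\<A>\<close> is enlarged by sets almost disjoint from \<open>C\<close>.
\<close>

definition settled :: "('a \<Rightarrow> nat option) \<Rightarrow> nat set set \<Rightarrow> nat set \<Rightarrow> bool" where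
  "settled f \<A> C \<longleftrightarrow>
    {a \<in> \<Lambda>. f a = None} \<notin> \<I> \<or> (\<exists>n. {a \<in> \<Lambda>. f a = Some n} \<notin> \<I>) \<or>
    (\<exists>A\<in>\<A>. {a \<in> \<Lambda>. f a \<in> Some ` A} \<notin> \<I>) \<or>
    (\<exists>F\<in>\<F>. f ` \<rho> F \<subseteq> Some ` C \<and> (\<forall>n. avoids F {a \<in> \<Lambda>. f a = Some n}) \<and>
      (\<forall>A\<in>\<A>. avoids F {a \<in> \<Lambda>. f a \<in> Some ` A}))"

text \<open>In the last alternative the values on \<open>\<rho> F\<close> lie in \<open>C\<close>,
  so within \<open>\<rho> F\<close> the preimage of a new member \<open>B\<close> is covered by the
  finitely many fibres over \<open>B \<inter> C\<close>. Afterwards \<open>C\<close> has done its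
  work and is relaxed to \<open>UNIV\<close>.\<close>

lemma settled_extend:
  assumes s: "settled f \<A> C" and "\<A> \<subseteq> \<B>" and fin: "\<And>B. B \<in> \<B> - \<A> \<Longrightarrow> finite (B \<inter> C)"
  shows "settled f \<B> UNIV"
proof -
  consider "{a \<in> \<Lambda>. f a = None} \<notin> \<I>" | n where "{a \<in> \<Lambda>. f a = Some n} \<notin> \<I>"
    | A where "A \<in> \<A>" "{a \<in> \<Lambda>. f a \<in> Some ` A} \<notin> \<I>"
    | F where "F \<in> \<F>" "f ` \<rho> F \<subseteq> Some ` C" "\<forall>n. avoids F {a \<in> \<Lambda>. f a = Some n}"
        "\<forall>A\<in>\<A>. avoids F {a \<in> \<Lambda>. f a \<in> Some ` A}"
    using s unfolding settled_def by blast
  then show ?thesis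
  proof cases
    case (3 A)
    then have "A \<in> \<B>" using \<open>\<A> \<subseteq> \<B>\<close> by blast
    with 3 show ?thesis unfolding settled_def by blast
  next
    case (4 F)
    have "avoids F {a \<in> \<Lambda>. f a \<in> Some ` B}" if "B \<in> \<B>" for B
    proof (cases "B \<in> \<A>")
      case False
      have "avoids F (\<Union>n\<in>B \<inter> C. {a \<in> \<Lambda>. f a = Some n})"
        using that False 4 by (intro avoids_UN fin) auto
      then show ?thesis
        by (rule avoids_mono[OF \<open>F \<in> \<F>\<close>]) (use 4(2) in auto)
    qed (use 4 in blast)
    moreover have "f ` \<rho> F \<subseteq> range Some" using 4(2) by auto
    ultimately show ?thesis using 4 unfolding settled_def by blast
  qed (auto simp: settled_def)
qed

text \<open>Functions will be recovered from codes on the naturals only up to their values off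
  \<open>\<Lambda>\<close>.\<close>

lemma settled_cong:
  assumes "\<And>a. a \<in> \<Lambda> \<Longrightarrow> f a = g a" "settled f \<A> C"
  shows "settled g \<A> C"
proof -
  have "{a \<in> \<Lambda>. f a \<in> S} = {a \<in> \<Lambda>. g a \<in> S}" for S using assms(1) by auto
  from this[of "{_}"] this[of "Some ` _"]
  have "{a \<in> \<Lambda>. f a = p} = {a \<in> \<Lambda>. g a = p}" "{a \<in> \<Lambda>. f a \<in> Some ` A} = {a \<in> \<Lambda>. g a \<in> Some ` A}"
    for p A by auto
  moreover have "f ` \<rho> F = g ` \<rho> F" if "F \<in> \<F>" for F
    using assms(1) \<rho>_infinite[OF that] by (intro image_cong) auto
  ultimately show ?thesis using assms(2) unfolding settled_def by simp
qed

end

text \<open>\<open>J\<close> stands for the second ideal carried over to the naturals by an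
  enumeration of its underlying set; \<open>not_katetov\<close> is the failure of the reduction,
  stated for \<open>J\<close>.\<close>

locale katetov_gap = partition_regular \<Lambda> \<Omega> \<F> \<rho>
  for \<Lambda> :: "'a set" and \<Omega> :: "'b set" and \<F> :: "'b set set" and \<rho> :: "'b set \<Rightarrow> 'a set" +
  fixes J :: "nat set set"
  assumes P_minus: "P_minus \<Lambda> \<Omega> \<F> \<rho>"
    and J_subset: "\<And>A B. A \<in> J \<Longrightarrow> B \<subseteq> A \<Longrightarrow> B \<in> J"
    and J_Un: "\<And>A B. A \<in> J \<Longrightarrow> B \<in> J \<Longrightarrow> A \<union> B \<in> J"
    and J_finite: "\<And>A. finite A \<Longrightarrow> A \<in> J"
    and not_katetov: "\<And>\<phi>. \<exists>A\<subseteq>\<Lambda>. A \<notin> \<I> \<and> \<phi> ` A \<in> J"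
begin

lemma J_UN: "finite S \<Longrightarrow> (\<And>j. j \<in> S \<Longrightarrow> A j \<in> J) \<Longrightarrow> (\<Union>j\<in>S. A j) \<in> J"
  by (induction rule: finite_induct) (auto intro: J_Un simp: J_finite)

text \<open>An injection of \<open>\<Lambda>\<close> into \<open>S\<close> is not a reduction, so it
  maps some positive, hence infinite, set onto a member of \<open>J\<close>.\<close>

lemma J_tall:
  assumes "infinite S"
  obtains T where "T \<subseteq> S" "infinite T" "T \<in> J"
proof -
  let ?\<phi> = "enumerate S \<circ> to_nat_on \<Lambda>"
  obtain A where A: "A \<subseteq> \<Lambda>" "A \<notin> \<I>" "?\<phi> ` A \<in> J" using not_katetov by blast
  have "inj_on ?\<phi> A"
    using A(1) countable_\<Lambda> inj_enumerate[OF assms]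
    by (intro comp_inj_on) (auto intro: inj_on_subset[OF inj_on_to_nat_on] inj_on_subset)
  moreover have "infinite A" using A ideal_finite by blast
  ultimately have "infinite (?\<phi> ` A)" using finite_imageD by blast
  moreover have "?\<phi> ` A \<subseteq> S" using enumerate_in_set[OF assms] by auto
  ultimately show ?thesis using A that by blast
qed

lemma pseudo_selector:
  assumes "countable \<C>" "\<C> \<subseteq> J" "decseq G" "\<And>n. G n \<notin> J"
  obtains A where "A \<in> J" "infinite A" "\<And>C. C \<in> \<C> \<Longrightarrow> finite (A \<inter> C)" "\<And>n. A \<inter> G n \<noteq> {}"
proof -
  define c where "c = from_nat_into (insert {} \<C>)"
  have c: "c n \<in> J" for n
    using from_nat_into[of "insert {} \<C>" n] assms(2) J_finite[of "{}"] unfolding c_def by auto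
  \<comment> \<open>Only a set of \<open>J\<close> is forbidden, while \<open>G i\<close> is not in
    \<open>J\<close>. The bound \<open>i \<le> a\<close> makes the set of chosen points
    infinite.\<close>
  have "\<exists>a. a \<in> G i \<and> i \<le> a \<and> (\<forall>j\<le>i. a \<notin> c j)" for i
  proof (rule ccontr)
    assume "\<nexists>a. a \<in> G i \<and> i \<le> a \<and> (\<forall>j\<le>i. a \<notin> c j)"
    then have "G i \<subseteq> {..<i} \<union> (\<Union>j\<in>{..i}. c j)" by (auto simp: not_le)
    moreover have "{..<i} \<union> (\<Union>j\<in>{..i}. c j) \<in> J"
      by (intro J_Un J_finite J_UN c) auto
    ultimately show False using assms(4) J_subset by blast
  qed
  then obtain a where a: "\<And>i. a i \<in> G i" "\<And>i. i \<le> a i" "\<And>i j. j \<le> i \<Longrightarrow> a i \<notin> c j"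
    by metis
  have "infinite (range a)"
    unfolding infinite_nat_iff_unbounded_le using a(2) by blast
  then obtain T where T: "T \<subseteq> range a" "infinite T" "T \<in> J" by (rule J_tall)
  show ?thesis
  proof
    show "T \<in> J" "infinite T" by fact+
    fix C assume "C \<in> \<C>"
    then obtain j where j: "C = c j"
      using assms(1) from_nat_into_surj[of "insert {} \<C>" C] unfolding c_def by auto
    have "T \<inter> C \<subseteq> a ` {..<j}"
    proof
      fix x assume x: "x \<in> T \<inter> C"
      then obtain i where i: "x = a i" using T(1) by blast
      then have "i < j" using a(3)[of j i] x j by (metis IntD2 not_le)
      then show "x \<in> a ` {..<j}" using i by blast
    qed
    then show "finite (T \<inter> C)" by (rule finite_subset) simp
  next
    fix n
    \<comment> \<open>Thinning out to \<open>T\<close> may lose \<open>a n\<close> itself, but some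
      later \<open>a i\<close> survives, and \<open>G i \<subseteq> G n\<close>.\<close>
    have "\<not> T \<subseteq> a ` {..<n}" using T(2) finite_subset by blast
    then obtain x where x: "x \<in> T" "x \<notin> a ` {..<n}" by blast
    then obtain i where i: "x = a i" using T(1) by blast
    then have "n \<le> i" using x by (auto simp: not_less[symmetric])
    then have "x \<in> G n" using a(1)[of i] i decseqD[OF assms(3), of n i] by blast
    then show "T \<inter> G n \<noteq> {}" using x by blast
  qed
qed

lemma exists_settled:
  assumes "countable \<A>"
  obtains C where "C \<in> J" "settled f \<A> C"
\<comment> \<open>With \<open>C = {}\<close> the last alternative is impossible, since
  \<open>\<rho> F\<close> is infinite. The split thus asks whether one of the first three
  holds.\<close>
proof (cases "settled f \<A> {}")
  case True
  then show ?thesis using that J_finite by blast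
next
  case False
  then have none: "{a \<in> \<Lambda>. f a = None} \<in> \<I>" and fib: "\<And>n. {a \<in> \<Lambda>. f a = Some n} \<in> \<I>"
    and pre: "\<And>A. A \<in> \<A> \<Longrightarrow> {a \<in> \<Lambda>. f a \<in> Some ` A} \<in> \<I>"
    unfolding settled_def by blast+
  \<comment> \<open>Where \<open>f\<close> is \<open>None\<close> the value is arbitrary; these
    points form a set in the ideal and are removed from \<open>B\<close> below.\<close>
  define \<phi> where "\<phi> a = the (f a)" for a
  obtain B where B: "B \<subseteq> \<Lambda>" "B \<notin> \<I>" "\<phi> ` B \<in> J" using not_katetov by blast
  let ?B = "B - {a \<in> \<Lambda>. f a = None}"
  have "?B \<notin> \<I>"
  proof
    assume "?B \<in> \<I>"
    then have "?B \<union> {a \<in> \<Lambda>. f a = None} \<in> \<I>" using none by (rule ideal_Un)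
    then have "B \<in> \<I>" by (rule ideal_subset) blast
    with B show False by simp
  qed
  let ?Z = "range (\<lambda>n. {a \<in> \<Lambda>. f a = Some n}) \<union> (\<lambda>A. {a \<in> \<Lambda>. f a \<in> Some ` A}) ` \<A>"
  have "?B \<subseteq> \<Lambda>" "countable ?Z" "?Z \<subseteq> \<I>" using B assms fib pre by auto
  then have "\<exists>F\<in>\<F>. \<rho> F \<subseteq> ?B \<and> (\<forall>Z\<in>?Z. avoids F Z)"
    using P_minus_avoids[OF P_minus _ \<open>?B \<notin> \<I>\<close>, of ?Z] by simp
  then obtain F where F: "F \<in> \<F>" "\<rho> F \<subseteq> ?B" and av: "\<forall>Z\<in>?Z. avoids F Z" by blast
  have "f a \<in> Some ` \<phi> ` B" if "a \<in> \<rho> F" for a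
  proof -
    have "a \<in> B" "f a \<noteq> None" using F(2) B(1) that by auto
    then show ?thesis unfolding \<phi>_def by (metis imageI option.exhaust_sel)
  qed
  then have "f ` \<rho> F \<subseteq> Some ` \<phi> ` B" by blast
  moreover have "\<forall>n. avoids F {a \<in> \<Lambda>. f a = Some n}" using av by simp
  moreover have "\<forall>A\<in>\<A>. avoids F {a \<in> \<Lambda>. f a \<in> Some ` A}" using av by simp
  ultimately have "settled f \<A> (\<phi> ` B)" unfolding settled_def using F(1) by blast
  with B show ?thesis using that by blast
qed

end

text \<open>Proper initial segments of the cardinal order on the reals have fewer elements than the
  reals, so under CH they are countable.\<close>

lemma CH_wellorder:
  assumes continuum_hypothesis
  obtains R :: "real rel" where "wf R" "\<And>x y. x \<noteq> y \<Longrightarrow> (x, y) \<in> R \<or> (y, x) \<in> R"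
    "\<And>x. countable {y. (y, x) \<in> R}"
proof
  let ?r = "|UNIV :: real set|"
  have wo: "well_order_on UNIV ?r" using card_of_well_order_on by blast
  show "wf (?r - Id)" using wo by (simp add: well_order_on_def)
  show "(x, y) \<in> ?r - Id \<or> (y, x) \<in> ?r - Id" if "x \<noteq> y" for x y
    using wo that by (auto simp: well_order_on_def linear_order_on_def total_on_def)
  show "countable {y. (y, x) \<in> ?r - Id}" for x
  proof -
    have "{y. (y, x) \<in> ?r - Id} = underS ?r x" by (auto simp: underS_def)
    moreover have "|underS ?r x| <o ?r" 
      by (rule card_of_underS[OF card_of_Card_order]) (simp add: Field_card_of)
    then have "|underS ?r x| <o cardSuc natLeq"
      using assms ordLess_ordIso_trans unfolding continuum_hypothesis_def by blast
    then have "|underS ?r x| \<le>o natLeq"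
      using cardSuc_ordLeq_ordLess[OF natLeq_Card_order card_of_Card_order] by blast
    ultimately show ?thesis by (simp add: countable_card_le_natLeq)
  qed
qed

lemma (in katetov_gap) almost_disjoint_construction:
  fixes G :: "real \<Rightarrow> nat \<Rightarrow> nat set" and h :: "real \<Rightarrow> 'a \<Rightarrow> nat option"
  assumes CH: continuum_hypothesis and G: "\<And>x. decseq (G x)" "\<And>x n. G x n \<notin> J"
  obtains A where "\<And>x. A x \<in> J" "\<And>x. infinite (A x)"
    "\<And>x y. x \<noteq> y \<Longrightarrow> finite (A x \<inter> A y)" "\<And>x n. A x \<inter> G x n \<noteq> {}"
    "\<And>x. settled (h x) (range A) UNIV"
proof -
  obtain R :: "real rel" where R: "wf R" "\<And>x y. x \<noteq> y \<Longrightarrow> (x, y) \<in> R \<or> (y, x) \<in> R"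
    "\<And>x. countable {y. (y, x) \<in> R}"
    using CH_wellorder[OF CH] by blast
  \<comment> \<open>Each stage yields a pair: the new member \<open>A\<close>, and the set
    \<open>C\<close> witnessing that \<open>h x\<close> is settled by the earlier members.
    \<open>A\<close> must be almost disjoint from its own \<open>C\<close> too, as it is not among
    those members.\<close>
  define P where "P f x r \<longleftrightarrow> (case r of (A, C) \<Rightarrow>
      A \<in> J \<and> infinite A \<and> C \<in> J \<and> finite (A \<inter> C) \<and> (\<forall>n. A \<inter> G x n \<noteq> {}) \<and>
      (\<forall>y. (y, x) \<in> R \<longrightarrow> finite (A \<inter> fst (f y)) \<and> finite (A \<inter> snd (f y))) \<and>
      settled (h x) ((\<lambda>y. fst (f y)) ` {y. (y, x) \<in> R}) C)"
    for f :: "real \<Rightarrow> nat set \<times> nat set" and x r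
  have "\<exists>f. \<forall>x. P f x (f x)"
  proof (rule dependent_wf_choice[OF R(1)])
    fix f g :: "real \<Rightarrow> nat set \<times> nat set" and x r
    assume eq: "\<And>z. (z, x) \<in> R \<Longrightarrow> f z = g z"
    then have "(\<lambda>y. fst (f y)) ` {y. (y, x) \<in> R} = (\<lambda>y. fst (g y)) ` {y. (y, x) \<in> R}"
      by (intro image_cong) auto
    then show "P f x r = P g x r" unfolding P_def by (simp add: eq cong: conj_cong)
  next
    fix x and f :: "real \<Rightarrow> nat set \<times> nat set"
    assume IH: "\<And>y. (y, x) \<in> R \<Longrightarrow> P f y (f y)"
    let ?B = "{y. (y, x) \<in> R}"
    \<comment> \<open>\<open>C\<close> is chosen first, so that it can be added to the countably
      many sets from which \<open>A\<close> must be almost disjoint.\<close>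
    obtain C where C: "C \<in> J" "settled (h x) ((\<lambda>y. fst (f y)) ` ?B) C"
      by (rule exists_settled[of "(\<lambda>y. fst (f y)) ` ?B" "h x"]) (use R(3) in auto)
    let ?C = "insert C ((\<lambda>y. fst (f y)) ` ?B \<union> (\<lambda>y. snd (f y)) ` ?B)"
    have "fst (f y) \<in> J \<and> snd (f y) \<in> J" if "(y, x) \<in> R" for y
      using IH[OF that] by (auto simp: P_def)
    then have "?C \<subseteq> J" using C(1) by auto
    moreover have "countable ?C" using R(3) by simp
    ultimately obtain A where A: "A \<in> J" "infinite A" "\<And>C. C \<in> ?C \<Longrightarrow> finite (A \<inter> C)"
        "\<And>n. A \<inter> G x n \<noteq> {}"
      using pseudo_selector[of ?C "G x"] G by metis
    have "P f x (A, C)" unfolding P_def prod.case using A C by blast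
    then show "\<exists>r. P f x r" by blast
  qed
  then obtain f where f: "\<And>x. P f x (f x)" by blast
  define A C where "A x = fst (f x)" and "C x = snd (f x)" for x
  have A: "A x \<in> J" "infinite (A x)" "finite (A x \<inter> C x)" "A x \<inter> G x n \<noteq> {}"
    "settled (h x) (A ` {y. (y, x) \<in> R}) (C x)" for x n
    using f[of x] by (auto simp: P_def A_def C_def case_prod_beta)
  have below: "finite (A x \<inter> A y)" "finite (A x \<inter> C y)" if "(y, x) \<in> R" for x y
    using f[of x] that by (auto simp: P_def A_def C_def case_prod_beta)
  have "settled (h x) (range A) UNIV" for x
  proof (rule settled_extend[OF A(5)])
    fix B assume "B \<in> range A - A ` {y. (y, x) \<in> R}"
    then obtain z where "B = A z" "(z, x) \<notin> R" by blast
    \<comment> \<open>Either \<open>z = x\<close>, or \<open>z\<close> comes after \<open>x\<close>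
      and its member was chosen with \<open>C x\<close> already known.\<close>
    then show "finite (B \<inter> C x)" using R(2)[of z x] below(2)[of x z] A(3)[of x] by auto
  qed blast
  moreover have "finite (A x \<inter> A y)" if "x \<noteq> y" for x y
    using R(2)[OF that] below(1) by (metis Int_commute)
  ultimately show ?thesis using A that by blast
qed

section \<open>Convergence in the compactification\<close>

context partition_regular
begin

text \<open>A positive fibre gives a constant restriction. If all fibres are small but the points of
  \<open>\<A>\<close> have positive preimage, a restriction tends to infinity. Otherwise
  \<open>f\<close> is, up to a set in the ideal, a map into the isolated points, and
  \<open>settled\<close> applies.\<close>

lemma FinBW_Phi_space:
  assumes P: "P_minus \<Lambda> \<Omega> \<F> \<rho>" and "mrowka (UNIV :: nat set) \<A>"
    and settled: "\<And>f. settled f \<A> UNIV"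
  shows "FinBW \<Lambda> \<Omega> \<F> \<rho> (Phi_space UNIV \<A>)"
  unfolding FinBW_def
proof
  interpret mrowka UNIV \<A> by fact
  fix f assume f: "f \<in> \<Lambda> \<rightarrow> topspace (Phi_space UNIV \<A>)"
  let ?fib = "\<lambda>p. {a \<in> \<Lambda>. f a = p}"
  let ?B = "{a \<in> \<Lambda>. f a \<in> Some ` range Inr}"
  let ?goal = "\<exists>F\<in>\<F>. \<exists>x. rho_convergent \<Omega> \<rho> F (Phi_space UNIV \<A>) f x"
  show ?goal
  proof (cases "\<forall>p. ?fib p \<in> \<I>")
    case False
    then obtain p where p: "?fib p \<notin> \<I>" by blast
    then obtain F where F: "F \<in> \<F>" "\<rho> F \<subseteq> ?fib p" by (rule positiveE) auto
    have "?fib p \<noteq> {}"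
    proof
      assume "?fib p = {}"
      with p ideal_finite[of "{}"] show False by simp
    qed
    then have "p \<in> topspace (Phi_space UNIV \<A>)" using f by auto
    then show ?thesis using F by (auto intro!: bexI[of _ F] exI[of _ p] rho_convergent_constant)
  next
    case fib: True
    show ?thesis
    proof (cases "?B \<in> \<I>")
      case False
      \<comment> \<open>Only fibres over attained values are listed: \<open>\<Z>\<close> must be
        countable, while \<open>\<A>\<close> may be uncountable.\<close>
      define \<Z> where "\<Z> = insert {} (?fib ` f ` \<Lambda>)"
      have "countable \<Z>" using countable_\<Lambda> by (simp add: \<Z>_def)
      moreover have "\<Z> \<subseteq> \<I>" using fib ideal_finite[of "{}"] by (auto simp: \<Z>_def)
      ultimately have "\<exists>F\<in>\<F>. \<rho> F \<subseteq> ?B \<and> (\<forall>Z\<in>\<Z>. avoids F Z)"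
        using False by (intro P_minus_avoids[OF P]) auto
      then obtain F where F: "F \<in> \<F>" "\<rho> F \<subseteq> ?B" and av: "\<forall>Z\<in>\<Z>. avoids F Z" by blast
      have "avoids F {a. f a \<in> Some ` Psi_nbhd x}" for x
      proof -
        have "avoids F (?fib (Some x))"
        proof (cases "Some x \<in> f ` \<Lambda>")
          case False
          then have "?fib (Some x) = {}" by force
          moreover have "avoids F {}" using av by (simp add: \<Z>_def)
          ultimately show ?thesis by (simp only:)
        next
          case True
          then have "?fib (Some x) \<in> \<Z>" unfolding \<Z>_def by (intro insertI2 imageI)
          with av show ?thesis by (rule bspec)
        qed
        \<comment> \<open>On \<open>\<rho> F\<close> all values are points of \<open>\<A>\<close>,
          and \<open>Psi_nbhd x\<close> contains no such point other than possibly
          \<open>x\<close>.\<close>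
        moreover have "\<rho> F \<inter> {a. f a \<in> Some ` Psi_nbhd x} \<subseteq> ?fib (Some x)"
        proof
          fix a assume a: "a \<in> \<rho> F \<inter> {a. f a \<in> Some ` Psi_nbhd x}"
          have "a \<in> ?B" by (rule subsetD[OF F(2)]) (rule IntD1[OF a])
          moreover have "f a \<in> Some ` Psi_nbhd x" using a by simp
          ultimately show "a \<in> ?fib (Some x)" by (cases x) auto
        qed
        ultimately show ?thesis by (rule avoids_mono[OF F(1)])
      qed
      then have "rho_convergent \<Omega> \<rho> F (Phi_space UNIV \<A>) f None"
        by (intro rho_convergent_infinity f F mrowka_axioms)
      with F show ?thesis by blast
    next
      case B: True
      \<comment> \<open>Infinity and all points of \<open>\<A>\<close> are merged into
        \<open>None\<close>, whose preimage is now in the ideal.\<close>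
      define g where "g a = (case f a of Some (Inl n) \<Rightarrow> Some n | _ \<Rightarrow> None)" for a
      have g_Some: "g a = Some n \<longleftrightarrow> f a = Some (Inl n)" for a n
        by (auto simp: g_def split: option.splits sum.splits)
      have g_None: "g a = None \<longleftrightarrow> f a = None \<or> f a \<in> Some ` range Inr" for a
        by (auto simp: g_def split: option.splits sum.splits)
      have "?fib None \<union> ?B \<in> \<I>" using fib B by (intro ideal_Un) auto
      moreover have "{a \<in> \<Lambda>. g a = None} = ?fib None \<union> ?B" by (auto simp: g_None)
      ultimately have "{a \<in> \<Lambda>. g a = None} \<in> \<I>" by simp
      moreover have "{a \<in> \<Lambda>. g a = Some n} \<in> \<I>" for n using fib by (simp add: g_Some)
      ultimately consider A where "A \<in> \<A>" "{a \<in> \<Lambda>. g a \<in> Some ` A} \<notin> \<I>"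
        | F where "F \<in> \<F>" "g ` \<rho> F \<subseteq> range Some" "\<forall>n. avoids F {a \<in> \<Lambda>. g a = Some n}"
          "\<forall>A\<in>\<A>. avoids F {a \<in> \<Lambda>. g a \<in> Some ` A}"
        using settled[of g] unfolding settled_def by blast
      then show ?thesis
      proof cases
        case (1 A)
        define \<Z> where "\<Z> = range (\<lambda>n. ?fib (Some (Inl n)))"
        have "\<Z> \<subseteq> \<I>" "countable \<Z>" using fib by (auto simp: \<Z>_def)
        then have "\<exists>F\<in>\<F>. \<rho> F \<subseteq> {a \<in> \<Lambda>. g a \<in> Some ` A} \<and> (\<forall>Z\<in>\<Z>. avoids F Z)"
          using 1 by (intro P_minus_avoids[OF P]) auto
        then obtain F where F: "F \<in> \<F>" "\<rho> F \<subseteq> {a \<in> \<Lambda>. g a \<in> Some ` A}"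
          and av: "\<forall>Z\<in>\<Z>. avoids F Z" by blast
        have "f a \<in> Some ` Inl ` A" if "a \<in> \<rho> F" for a
        proof -
          obtain n where "n \<in> A" "g a = Some n" using F(2) \<open>a \<in> \<rho> F\<close> by auto
          then show ?thesis by (simp add: g_Some)
        qed
        then have "rho_convergent \<Omega> \<rho> F (Phi_space UNIV \<A>) f (Some (Inr A))"
          using av 1 F by (intro rho_convergent_member mrowka_axioms) (auto simp: \<Z>_def)
        with F show ?thesis by blast
      next
        case (2 F)
        have "avoids F {a. f a \<in> Some ` Psi_nbhd x}" if "x \<in> Inl ` UNIV \<union> Inr ` \<A>" for x
        proof (cases x)
          case (Inl n)
          have "avoids F {a \<in> \<Lambda>. g a = Some n}" using 2 by blast
          then show ?thesis
            by (rule avoids_mono[OF 2(1)]) (use Inl \<rho>_infinite[OF 2(1)] in \<open>auto simp: g_Some\<close>)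
        next
          case (Inr A)
          then have "avoids F {a \<in> \<Lambda>. g a \<in> Some ` A}" using 2 that by blast
          \<comment> \<open>The centre \<open>Inr A\<close> is not a value of \<open>f\<close> on
            \<open>\<rho> F\<close>, because \<open>g\<close> is never \<open>None\<close>
            there.\<close>
          moreover have "\<rho> F \<inter> {a. f a \<in> Some ` Psi_nbhd x} \<subseteq> {a \<in> \<Lambda>. g a \<in> Some ` A}"
          proof
            fix a assume a: "a \<in> \<rho> F \<inter> {a. f a \<in> Some ` Psi_nbhd x}"
            then have "a \<in> \<rho> F" by simp
            then have "a \<in> \<Lambda>" "g a \<noteq> None" using \<rho>_infinite[OF 2(1)] 2(2) by auto
            then have "f a \<noteq> Some (Inr A)" by (auto simp: g_None)
            moreover have "f a \<in> Some ` Psi_nbhd x" using a by simp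
            ultimately obtain n where "n \<in> A" "f a = Some (Inl n)" using Inr by auto
            then have "g a \<in> Some ` A" using g_Some by (metis imageI)
            with \<open>a \<in> \<Lambda>\<close> show "a \<in> {a \<in> \<Lambda>. g a \<in> Some ` A}" by simp
          qed
          ultimately show ?thesis by (rule avoids_mono[OF 2(1)])
        qed
        then have "rho_convergent \<Omega> \<rho> F (Phi_space UNIV \<A>) f None"
          by (intro rho_convergent_infinity f 2 mrowka_axioms)
        with 2 show ?thesis by blast
      qed
    qed
  qed
qed

text \<open>The test map sends \<open>\<Lambda>\<close> through \<open>g\<close> to isolated points.
  A limit other than infinity would trap some \<open>\<rho> (F - K)\<close> in a set of the ideal.
  Infinity fails because the member given by \<open>hit\<close> meets the image of every
  tail.\<close>

lemma not_FinBW_Phi_space: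
  fixes g :: "'a \<Rightarrow> nat"
  assumes "mrowka UNIV \<A>" and g: "inj_on g \<Lambda>"
    and small: "\<And>A. A \<in> \<A> \<Longrightarrow> {a \<in> \<Lambda>. g a \<in> A} \<in> \<I>"
    and hit: "\<And>F. F \<in> \<F> \<Longrightarrow> \<exists>A\<in>\<A>. \<forall>K\<subseteq>\<Omega>. finite K \<longrightarrow> g ` \<rho> (F - K) \<inter> A \<noteq> {}"
  shows "\<not> FinBW \<Lambda> \<Omega> \<F> \<rho> (Phi_space UNIV \<A>)"
proof
  interpret mrowka UNIV \<A> by fact
  let ?f = "\<lambda>a. Some (Inl (g a))"
  assume "FinBW \<Lambda> \<Omega> \<F> \<rho> (Phi_space UNIV \<A>)"
  moreover have "?f \<in> \<Lambda> \<rightarrow> topspace (Phi_space UNIV \<A>)" by (auto simp: topspace_Phi)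
  ultimately obtain F p where F: "F \<in> \<F>" and "rho_convergent \<Omega> \<rho> F (Phi_space UNIV \<A>) ?f p"
    unfolding FinBW_def by blast
  then have p: "p \<in> topspace (Phi_space UNIV \<A>)"
    and conv: "\<And>U. openin (Phi_space UNIV \<A>) U \<Longrightarrow> p \<in> U \<Longrightarrow>
      \<exists>K\<subseteq>\<Omega>. finite K \<and> ?f ` \<rho> (F - K) \<subseteq> U"
    unfolding rho_convergent_def by auto
  consider x where "p = Some x" "x \<in> topspace (Psi_space UNIV \<A>)" | "p = None"
    using p by (auto simp: topspace_Phi topspace_Psi)
  then show False
  proof cases
    case (1 x)
    have "openin (Phi_space UNIV \<A>) (Some ` Psi_nbhd x)"
      using openin_Psi_nbhd[OF 1(2)] by (simp add: openin_Phi_Some)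
    moreover have "p \<in> Some ` Psi_nbhd x" using 1 Psi_nbhd_self by blast
    ultimately obtain K where K: "K \<subseteq> \<Omega>" "finite K" "?f ` \<rho> (F - K) \<subseteq> Some ` Psi_nbhd x"
      using conv by blast
    have FK: "F - K \<in> \<F>" using \<F>_Diff F K by blast
    have "{a \<in> \<Lambda>. Inl (g a) \<in> Psi_nbhd x} \<in> \<I>"
    proof (cases x)
      case (Inl n)
      have "finite {a \<in> \<Lambda>. g a = n}"
        by (rule finite_imageD[of g])
          (use g in \<open>auto intro: inj_on_subset finite_subset[of _ "{n}"]\<close>)
      then show ?thesis using Inl by (intro ideal_finite) auto
    next
      case (Inr A)
      then have "A \<in> \<A>" using 1 by (auto simp: topspace_Psi)
      moreover have "{a \<in> \<Lambda>. Inl (g a) \<in> Psi_nbhd x} = {a \<in> \<Lambda>. g a \<in> A}" using Inr by auto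
      ultimately show ?thesis using small by simp
    qed
    moreover have "\<rho> (F - K) \<subseteq> {a \<in> \<Lambda>. Inl (g a) \<in> Psi_nbhd x}"
      using K(3) \<rho>_infinite[OF FK] by auto
    ultimately show False using FK by (auto simp: ideal_of_def)
  next
    case 2
    obtain A where A: "A \<in> \<A>" "\<And>K. K \<subseteq> \<Omega> \<Longrightarrow> finite K \<Longrightarrow> g ` \<rho> (F - K) \<inter> A \<noteq> {}"
      using hit[OF F] by blast
    have "Inr A \<in> topspace (Psi_space UNIV \<A>)" using A by (simp add: topspace_Psi)
    from openin_Phi_Compl_nbhd[OF this] obtain K where "K \<subseteq> \<Omega>" "finite K"
      "?f ` \<rho> (F - K) \<subseteq> insert None (Some ` (topspace (Psi_space UNIV \<A>) - Psi_nbhd (Inr A)))"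
      using conv 2 by blast
    then show False using A(2)[of K] by auto
  qed
qed

lemma FinBW_homeomorphic:
  assumes "X homeomorphic_space Y" and X: "FinBW \<Lambda> \<Omega> \<F> \<rho> X"
  shows "FinBW \<Lambda> \<Omega> \<F> \<rho> Y"
  unfolding FinBW_def
proof
  obtain p q where p: "continuous_map X Y p" and q: "continuous_map Y X q"
    and pq: "\<And>y. y \<in> topspace Y \<Longrightarrow> p (q y) = y"
    using assms(1) unfolding homeomorphic_space_def homeomorphic_maps_def by blast
  fix f assume f: "f \<in> \<Lambda> \<rightarrow> topspace Y"
  then have "q \<circ> f \<in> \<Lambda> \<rightarrow> topspace X"
    using continuous_map_image_subset_topspace[OF q] by (auto simp: Pi_iff image_subset_iff)
  then obtain F x where F: "F \<in> \<F>" and conv: "rho_convergent \<Omega> \<rho> F X (q \<circ> f) x"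
    using X unfolding FinBW_def by blast
  have "\<exists>K\<subseteq>\<Omega>. finite K \<and> f ` \<rho> (F - K) \<subseteq> U" if U: "openin Y U" "p x \<in> U" for U
  proof -
    have "openin X {z \<in> topspace X. p z \<in> U}"
      using openin_continuous_map_preimage[OF p U(1)] .
    moreover have "x \<in> {z \<in> topspace X. p z \<in> U}"
      using conv U by (auto simp: rho_convergent_def)
    ultimately obtain K where K: "K \<subseteq> \<Omega>" "finite K"
      "(q \<circ> f) ` \<rho> (F - K) \<subseteq> {z \<in> topspace X. p z \<in> U}"
      using conv unfolding rho_convergent_def by blast
    have FK: "\<rho> (F - K) \<subseteq> \<Lambda>" using \<F>_Diff[OF F K(2,1)] \<rho>_infinite by blast
    have "f a \<in> U" if "a \<in> \<rho> (F - K)" for a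
    proof -
      have "p (q (f a)) \<in> U" using K(3) that by auto
      moreover have "p (q (f a)) = f a" using pq f FK that by blast
      ultimately show ?thesis by simp
    qed
    with K show ?thesis by blast
  qed
  moreover have "p x \<in> topspace Y"
    using conv continuous_map_image_subset_topspace[OF p] by (auto simp: rho_convergent_def)
  ultimately have "rho_convergent \<Omega> \<rho> F Y f (p x)" by (simp add: rho_convergent_def)
  with F show "\<exists>F\<in>\<F>. \<exists>y. rho_convergent \<Omega> \<rho> F Y f y" by blast
qed

end

section \<open>Cardinalities and a homeomorphic copy on the reals\<close>

lemma homeomorphic_copy_on_UNIV:
  assumes "topspace Y \<approx> (UNIV :: 'x set)"
  obtains X :: "'x topology" where "topspace X = UNIV" "X homeomorphic_space Y"
proof -
  obtain p where p: "bij_betw p (UNIV :: 'x set) (topspace Y)"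
    using assms eqpoll_sym unfolding eqpoll_def by blast
  let ?X = "pullback_topology UNIV p Y"
  have range: "range p = topspace Y" and inj: "inj p" using p by (auto simp: bij_betw_def)
  have top: "topspace ?X = UNIV" using range by (auto simp: topspace_pullback_topology)
  have "continuous_map ?X Y p"
    using continuous_map_pullback[of Y Y id UNIV p] by simp
  moreover have "open_map ?X Y p"
    unfolding open_map_def openin_pullback_topology
  proof safe
    fix U assume U: "openin Y U"
    have "p ` (p -` U \<inter> UNIV) = U" using range openin_subset[OF U] by auto
    with U show "openin Y (p ` (p -` U \<inter> UNIV))" by simp
  qed
  ultimately have "homeomorphic_map ?X Y p"
    by (intro bijective_open_imp_homeomorphic_map) (use top range inj in auto)
  then show ?thesis using that[OF top] homeomorphic_map_imp_homeomorphic_space by blast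
qed

lemma lepoll_imp_surj:
  assumes "(UNIV :: 'x set) \<lesssim> (UNIV :: 'y set)"
  obtains s :: "'y \<Rightarrow> 'x" where "surj s"
  using assms unfolding lepoll_iff by auto

lemma partial_functions_lepoll_nat_sets:
  "(UNIV :: (nat \<Rightarrow> nat option) set) \<lesssim> (UNIV :: nat set set)"
  unfolding lepoll_def
proof (intro exI conjI)
  \<comment> \<open>A partial function is coded by its graph.\<close>
  let ?e = "\<lambda>f. {prod_encode (n, m) |n m. f n = Some m}"
  show "inj ?e"
  proof (rule injI, rule ext)
    fix f g :: "nat \<Rightarrow> nat option" and n
    assume eq: "?e f = ?e g"
    have "f n = Some m \<longleftrightarrow> prod_encode (n, m) \<in> ?e f" for f m by auto
    with eq have "f n = Some m \<longleftrightarrow> g n = Some m" for m by blast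
    then show "f n = g n" by (metis not_Some_eq)
  qed
qed simp

lemma Phi_space_eqpoll_reals:
  fixes A :: "real \<Rightarrow> nat set"
  assumes "mrowka UNIV (range A)" "inj A"
  shows "topspace (Phi_space UNIV (range A)) \<approx> (UNIV :: real set)"
proof (rule lepoll_antisym)
  interpret mrowka UNIV "range A" by fact
  show "topspace (Phi_space UNIV (range A)) \<lesssim> (UNIV :: real set)"
  proof -
    let ?C = "insert None (Some ` range Inl) :: (nat + nat set) option set"
    have inf: "infinite (UNIV :: real set)" by (rule infinite_UNIV_char_0)
    have "countable ?C" by simp
    then have "|?C| \<le>o |UNIV :: real set|"
      using inf infinite_iff_natLeq_ordLeq ordLeq_transitive
      unfolding countable_card_le_natLeq by blast
    then have "|?C \<union> range (\<lambda>x. Some (Inr (A x)))| \<le>o |UNIV :: real set|"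
      by (intro card_of_Un_ordLeq_infinite_Field card_of_image card_of_Card_order)
        (simp add: Field_card_of inf)
    moreover have "topspace (Phi_space UNIV (range A)) = ?C \<union> range (\<lambda>x. Some (Inr (A x)))"
      by (simp add: topspace_Phi image_Un image_image)
    ultimately show ?thesis by (simp only: lepoll_def card_of_ordLeq)
  qed
  show "(UNIV :: real set) \<lesssim> topspace (Phi_space UNIV (range A))"
    unfolding lepoll_def
  proof (intro exI conjI)
    show "inj (\<lambda>x. Some (Inr (A x)))" by (rule injI) (use assms(2) in \<open>simp add: inj_eq\<close>)
    show "range (\<lambda>x. Some (Inr (A x))) \<subseteq> topspace (Phi_space UNIV (range A))"
      by (auto simp: topspace_Phi)
  qed
qed

section \<open>Coding both partition regular functions by reals and assembling the result\<close>

theorem theorem14p3: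
  fixes \<Lambda>1 :: "'a set" and \<Omega>1 :: "'b set" and \<F>1 :: "'b set set" and \<rho>1 :: "'b set \<Rightarrow> 'a set"
    and \<Lambda>2 :: "'c set" and \<Omega>2 :: "'d set" and \<F>2 :: "'d set set" and \<rho>2 :: "'d set \<Rightarrow> 'c set"
  assumes "continuum_hypothesis"
    and "partition_regular \<Lambda>1 \<Omega>1 \<F>1 \<rho>1"
    and "partition_regular \<Lambda>2 \<Omega>2 \<F>2 \<rho>2"
    and "P_minus \<Lambda>1 \<Omega>1 \<F>1 \<rho>1"
    and "\<not> katetov_le \<Lambda>2 (ideal_of \<Lambda>2 \<F>2 \<rho>2) \<Lambda>1 (ideal_of \<Lambda>1 \<F>1 \<rho>1)"
  shows "(\<exists>(\<Lambda> :: nat set) \<A>.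
            countable \<Lambda> \<and> infinite \<Lambda> \<and> almost_disjoint_family \<Lambda> \<A> \<and>
            |\<A>| =o |UNIV :: real set| \<and>
            FinBW \<Lambda>1 \<Omega>1 \<F>1 \<rho>1 (Phi_space \<Lambda> \<A>) \<and>
            \<not> FinBW \<Lambda>2 \<Omega>2 \<F>2 \<rho>2 (Phi_space \<Lambda> \<A>))
       \<and> (\<exists>X :: real topology.
            Hausdorff_space X \<and> compact_space X \<and> separable_space X \<and>
            |topspace X| =o |UNIV :: real set| \<and>
            FinBW \<Lambda>1 \<Omega>1 \<F>1 \<rho>1 X \<and> \<not> FinBW \<Lambda>2 \<Omega>2 \<F>2 \<rho>2 X)"
proof -
  interpret P1: partition_regular \<Lambda>1 \<Omega>1 \<F>1 \<rho>1 by fact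
  interpret P2: partition_regular \<Lambda>2 \<Omega>2 \<F>2 \<rho>2 by fact
  define g where "g = to_nat_on \<Lambda>2"
  have g: "inj_on g \<Lambda>2" unfolding g_def using P2.countable_\<Lambda> by (rule inj_on_to_nat_on)
  define J where "J = {S. {a \<in> \<Lambda>2. g a \<in> S} \<in> P2.\<I>}"
  interpret katetov_gap \<Lambda>1 \<Omega>1 \<F>1 \<rho>1 J
  proof
    show "P_minus \<Lambda>1 \<Omega>1 \<F>1 \<rho>1" by fact
    show "B \<in> J" if "A \<in> J" "B \<subseteq> A" for A B
      using that(1) unfolding J_def mem_Collect_eq
      by (rule P2.ideal_subset) (use that(2) in blast)
    show "A \<union> B \<in> J" if "A \<in> J" "B \<in> J" for A B
    proof -
      have "{a \<in> \<Lambda>2. g a \<in> A \<union> B} = {a \<in> \<Lambda>2. g a \<in> A} \<union> {a \<in> \<Lambda>2. g a \<in> B}" by auto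
      with that P2.ideal_Un show ?thesis by (simp add: J_def)
    qed
    show "A \<in> J" if "finite A" for A
    proof -
      have "finite {a \<in> \<Lambda>2. g a \<in> A}"
        using finite_vimage_IntI[OF that g] by (simp add: vimage_def Int_def conj_commute)
      then show ?thesis by (simp add: J_def P2.ideal_finite)
    qed
    show "\<exists>A\<subseteq>\<Lambda>1. A \<notin> P1.\<I> \<and> \<phi> ` A \<in> J" for \<phi>
    proof -
      let ?\<psi> = "\<lambda>a. from_nat_into \<Lambda>2 (\<phi> a)"
      have "?\<psi> \<in> \<Lambda>1 \<rightarrow> \<Lambda>2" using P2.infinite_\<Lambda> from_nat_into by (metis Pi_I finite.emptyI)
      then obtain A where A: "A \<subseteq> \<Lambda>1" "A \<notin> P1.\<I>" "?\<psi> ` A \<in> P2.\<I>"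
        using assms(5) unfolding katetov_le_def by blast
      have "{a \<in> \<Lambda>2. g a \<in> \<phi> ` A} \<subseteq> ?\<psi> ` A"
      proof
        fix a assume "a \<in> {a \<in> \<Lambda>2. g a \<in> \<phi> ` A}"
        then obtain b where "a \<in> \<Lambda>2" "b \<in> A" "g a = \<phi> b" by blast
        moreover then have "from_nat_into \<Lambda>2 (\<phi> b) = a"
          using P2.countable_\<Lambda> by (metis g_def from_nat_into_to_nat_on)
        ultimately show "a \<in> ?\<psi> ` A" by blast
      qed
      with A P2.ideal_subset show ?thesis unfolding J_def by blast
    qed
  qed
  \<comment> \<open>The reals index the stages: \<open>s\<close> lists codes of the sets in
    \<open>\<F>2\<close>, and \<open>t\<close> codes of the functions on \<open>\<Lambda>1\<close>.
    Every set and every function is met at some stage, not necessarily the same one.\<close>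
  obtain s :: "real \<Rightarrow> nat set" where s: "surj s"
    using lepoll_imp_surj nat_sets_eqpoll_reals eqpoll_imp_lepoll by blast
  obtain t :: "real \<Rightarrow> nat \<Rightarrow> nat option" where t: "surj t"
    using lepoll_imp_surj lepoll_trans[OF partial_functions_lepoll_nat_sets]
      nat_sets_eqpoll_reals eqpoll_imp_lepoll by blast
  obtain F0 where F0: "F0 \<in> \<F>2" using P2.\<F>_nonempty by blast
  define code where "code x = {w \<in> \<Omega>2. to_nat_on \<Omega>2 w \<in> s x}" for x
  \<comment> \<open>\<open>F0\<close> is a default for reals that code no member of
    \<open>\<F>2\<close>.\<close>
  define Fam where "Fam x = (if code x \<in> \<F>2 then code x else F0)" for x
  have Fam: "Fam x \<in> \<F>2" for x using F0 by (simp add: Fam_def)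
  \<comment> \<open>Every finite subset of \<open>\<Omega>2\<close> lies in some \<open>K n\<close>,
    so this sequence of tails controls all tails.\<close>
  define K where "K n = {w \<in> \<Omega>2. to_nat_on \<Omega>2 w < n}" for n
  have K: "finite (K n)" "K n \<subseteq> \<Omega>2" for n
    using finite_vimage_IntI[of "{..<n}" "to_nat_on \<Omega>2" \<Omega>2] P2.countable_\<Omega>
    by (auto simp: K_def vimage_def Int_def conj_commute)
  define G where "G x n = g ` \<rho>2 (Fam x - K n)" for x n
  have "decseq (G x)" for x
  proof (rule antimonoI)
    fix m n :: nat assume "m \<le> n"
    then have "K m \<subseteq> K n" by (auto simp: K_def)
    then show "G x n \<subseteq> G x m"
      unfolding G_def by (intro image_mono P2.\<rho>_Diff_mono Fam K)
  qed
  moreover have "G x n \<notin> J" for x n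
  proof -
    have E: "Fam x - K n \<in> \<F>2" using P2.\<F>_Diff Fam K by blast
    then have "\<rho>2 (Fam x - K n) \<subseteq> {a \<in> \<Lambda>2. g a \<in> G x n}"
      using P2.\<rho>_infinite by (auto simp: G_def)
    then show ?thesis using E unfolding J_def ideal_of_def by blast
  qed
  ultimately obtain A where A: "\<And>x. A x \<in> J" "\<And>x. infinite (A x)"
    "\<And>x y. x \<noteq> y \<Longrightarrow> finite (A x \<inter> A y)" "\<And>x n. A x \<inter> G x n \<noteq> {}"
    and settled: "\<And>x. P1.settled (\<lambda>a. t x (to_nat_on \<Lambda>1 a)) (range A) UNIV"
    using almost_disjoint_construction[OF assms(1), of G "\<lambda>x a. t x (to_nat_on \<Lambda>1 a)"]
    by metis
  have "inj A"
  proof (rule injI, rule ccontr)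
    fix x y assume "A x = A y" "x \<noteq> y"
    then show False using A(2)[of x] A(3)[of x y] by simp
  qed
  have adf: "almost_disjoint_family UNIV (range A)"
    unfolding almost_disjoint_family_def
  proof (intro conjI ballI impI)
    fix B C assume "B \<in> range A" "C \<in> range A" "B \<noteq> C"
    then obtain x y where "B = A x" "C = A y" "x \<noteq> y" by auto
    then show "finite (B \<inter> C)" using A(3) by simp
  qed (use A(2) in auto)
  then interpret M: mrowka UNIV "range A" by unfold_locales
  let ?Phi = "Phi_space UNIV (range A)"
  have FinBW1: "FinBW \<Lambda>1 \<Omega>1 \<F>1 \<rho>1 ?Phi"
  proof (rule P1.FinBW_Phi_space[OF assms(4) M.mrowka_axioms])
    fix f :: "'a \<Rightarrow> nat option"
    obtain x where x: "t x = (\<lambda>n. f (from_nat_into \<Lambda>1 n))" using t by (metis surjD)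
    show "P1.settled f (range A) UNIV"
      by (rule P1.settled_cong[OF _ settled[of x]]) (simp add: x P1.countable_\<Lambda>)
  qed
  have not_FinBW2: "\<not> FinBW \<Lambda>2 \<Omega>2 \<F>2 \<rho>2 ?Phi"
  proof (rule P2.not_FinBW_Phi_space[OF M.mrowka_axioms g])
    show "{a \<in> \<Lambda>2. g a \<in> B} \<in> P2.\<I>" if "B \<in> range A" for B
      using that A(1) by (auto simp: J_def)
    fix F assume F: "F \<in> \<F>2"
    obtain x where x: "s x = to_nat_on \<Omega>2 ` F" using s by (metis surjD)
    have "code x = F"
      using P2.\<F>_infinite[OF F] inj_on_to_nat_on[OF P2.countable_\<Omega>]
      by (auto simp: code_def x dest: inj_onD)
    then have x: "Fam x = F" using F by (simp add: Fam_def)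
    have "g ` \<rho>2 (F - L) \<inter> A x \<noteq> {}" if L: "L \<subseteq> \<Omega>2" "finite L" for L
    proof -
      obtain n where n: "\<forall>w\<in>L. to_nat_on \<Omega>2 w < n"
        using finite_nat_set_iff_bounded[of "to_nat_on \<Omega>2 ` L"] L by auto
      then have "L \<subseteq> K n" using L by (auto simp: K_def)
      then have "G x n \<subseteq> g ` \<rho>2 (F - L)"
        unfolding G_def x using L by (intro image_mono P2.\<rho>_Diff_mono F K)
      then show ?thesis using A(4)[of x n] by blast
    qed
    then show "\<exists>B\<in>range A. \<forall>L\<subseteq>\<Omega>2. finite L \<longrightarrow> g ` \<rho>2 (F - L) \<inter> B \<noteq> {}" by blast
  qed
  have "bij_betw A UNIV (range A)" using \<open>inj A\<close> by (simp add: bij_betw_def)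
  then have "|range A| =o |UNIV :: real set|"
    using card_of_ordIso ordIso_symmetric by blast
  moreover obtain X :: "real topology" where X: "topspace X = UNIV" "X homeomorphic_space ?Phi"
    using homeomorphic_copy_on_UNIV[OF Phi_space_eqpoll_reals[OF M.mrowka_axioms \<open>inj A\<close>]] .
  have "Hausdorff_space X" "compact_space X" "separable_space X"
    using M.Hausdorff_space_Phi M.compact_space_Phi M.separable_space_Phi A(2)
      homeomorphic_Hausdorff_space[OF X(2)] homeomorphic_compact_space[OF X(2)]
      homeomorphic_separable_space[OF X(2)]
    by auto
  moreover have "|topspace X| =o |UNIV :: real set|" by (simp add: X(1) card_of_refl)
  moreover have "FinBW \<Lambda>1 \<Omega>1 \<F>1 \<rho>1 X"
    using X(2)[THEN homeomorphic_space_sym[THEN iffD1]] FinBW1 by (rule P1.FinBW_homeomorphic)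
  moreover have "\<not> FinBW \<Lambda>2 \<Omega>2 \<F>2 \<rho>2 X"
    using P2.FinBW_homeomorphic[OF X(2)] not_FinBW2 by (rule contrapos_nn[rotated])
  ultimately show ?thesis using adf FinBW1 not_FinBW2
    by (intro conjI exI[of _ UNIV] exI[of _ "range A"] exI[of _ X])
      (simp_all add: infinite_UNIV_nat)
qed

end
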